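(* Let $(G,\sigma)$ be a connection graph and $i\neq j\in V$. Writing $\mathcal{C}^\sigma(i,j)=\begin{bmatrix}\mathcal{C}^\sigma_{ii}&\mathcal{C}^\sigma_{ij}\\ \mathcal{C}^\sigma_{ji}&\mathcal{C}^\sigma_{jj}\end{bmatrix}$, the block $\mathcal{C}^\sigma_{ii}$ is invertible and $$\Omega^0_{ij}=-(\mathcal{C}^\sigma_{ii})^{-1}\mathcal{C}^\sigma_{ij}.$$
   Context: A connection graph $(G,\sigma)$: finite connected weighted graph $G=(V,E,W)$, $V=\{1,\dots,n\}$, $w_{xy}>0$ iff $\{x,y\}\in E$, $\deg(x)=\sum_y w_{xy}$, and $\sigma$ mapping oriented edges to $\mathsf{O}(d)$ with $\sigma_{yx}=\sigma_{xy}^{\mathrm T}$. Connection Laplacian $\mathcal{L}$: $nd\times nd$ block matrix with blocks $\deg(x)I_d$ on the diagonal, $-w_{xy}\sigma_{xy}$ for $x\sim y$, $0$ otherwise. For $M=\begin{bmatrix}A&B\\C&D\end{bmatrix}$, $M/D=A-BD^\dagger C$. The conductance matrix $\mathcal{C}^\sigma(i,j)=\mathcal{L}/\mathcal{L}_{\{i,j\}^c,\{i,j\}^c}\in\mathbb{R}^{2d\times 2d}$, blocks ordered $i$ then $j$. $(X_t)$: simple random walk with transition probabilities $w_{xy}/\deg(x)$; $T^0_j=\inf\{t\ge0:X_t=j\}$; $\Omega^0_{ij}=\mathbb{E}\big[\prod_{\ell=1}^{T^0_j}\sigma_{X_{\ell-1}X_\ell}\mid X_0=i\big]$ (ordered product).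 *)

theory Defs
  imports "HOL-Analysis.Analysis"
begin

text \<open>Matrices over an arbitrary finite index set S are represented as functions
  'i \<Rightarrow> 'i \<Rightarrow> real; only their values on S \<times> S matter.\<close>

definition mmul_on :: "'i set \<Rightarrow> ('i \<Rightarrow> 'i \<Rightarrow> real) \<Rightarrow> ('i \<Rightarrow> 'i \<Rightarrow> real) \<Rightarrow> ('i \<Rightarrow> 'i \<Rightarrow> real)" where
  "mmul_on S A B = (\<lambda>a b. \<Sum>c\<in>S. A a c * B c b)"

text \<open>Moore--Penrose pseudoinverse of the square matrix M restricted to S \<times> S
  (the unique matrix supported on S \<times> S satisfying the four Penrose equations on S).\<close>
definition pinv_on :: "'i set \<Rightarrow> ('i \<Rightarrow> 'i \<Rightarrow> real) \<Rightarrow> ('i \<Rightarrow> 'i \<Rightarrow> real)" where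
  "pinv_on S M = (THE X. (\<forall>a b. (a \<notin> S \<or> b \<notin> S) \<longrightarrow> X a b = 0) \<and>
      (\<forall>a\<in>S. \<forall>b\<in>S.
         mmul_on S (mmul_on S M X) M a b = M a b \<and>
         mmul_on S (mmul_on S X M) X a b = X a b \<and>
         mmul_on S M X a b = mmul_on S M X b a \<and>
         mmul_on S X M a b = mmul_on S X M b a))"

text \<open>Schur complement M/D, where D = M restricted to S \<times> S and A is M restricted
  to the complement of S; entries are meaningful for a, b outside S.\<close>
definition schur_on :: "'i set \<Rightarrow> ('i \<Rightarrow> 'i \<Rightarrow> real) \<Rightarrow> ('i \<Rightarrow> 'i \<Rightarrow> real)" where
  "schur_on S M = (\<lambda>a b. M a b - (\<Sum>c\<in>S. \<Sum>e\<in>S. M a c * pinv_on S M c e * M e b))"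

text \<open>Connection graphs: vertices of a finite type 'v, dimension d = CARD('d).\<close>

definition deg :: "('v::finite \<Rightarrow> 'v \<Rightarrow> real) \<Rightarrow> 'v \<Rightarrow> real" where
  "deg w x = (\<Sum>y\<in>UNIV. w x y)"

definition connection_graph ::
  "('v::finite \<Rightarrow> 'v \<Rightarrow> real) \<Rightarrow> ('v \<Rightarrow> 'v \<Rightarrow> real^'d::finite^'d) \<Rightarrow> bool" where
  "connection_graph w \<sigma> \<longleftrightarrow>
     (\<forall>x y. w x y \<ge> 0) \<and> (\<forall>x y. w x y = w y x) \<and> (\<forall>x. w x x = 0) \<and>
     (\<forall>x y. (\<lambda>u v. w u v > 0)\<^sup>*\<^sup>* x y) \<and>
     (\<forall>x y. w x y > 0 \<longrightarrow> orthogonal_matrix (\<sigma> x y) \<and> \<sigma> y x = transpose (\<sigma> x y))"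

text \<open>Connection Laplacian, indexed by pairs (vertex, coordinate).  For non-adjacent
  distinct x, y the entry is -w x y * ... = 0.\<close>
definition conn_laplacian ::
  "('v::finite \<Rightarrow> 'v \<Rightarrow> real) \<Rightarrow> ('v \<Rightarrow> 'v \<Rightarrow> real^'d::finite^'d) \<Rightarrow> ('v \<times> 'd) \<Rightarrow> ('v \<times> 'd) \<Rightarrow> real" where
  "conn_laplacian w \<sigma> = (\<lambda>(x, a) (y, b).
     if x = y then (if a = b then deg w x else 0) else - w x y * (\<sigma> x y $ a $ b))"

text \<open>Conductance matrix C^\<sigma>(i,j) = L / L_{{i,j}^c,{i,j}^c}, indexed by {i,j} \<times> 'd.\<close>
definition conductance ::
  "('v::finite \<Rightarrow> 'v \<Rightarrow> real) \<Rightarrow> ('v \<Rightarrow> 'v \<Rightarrow> real^'d::finite^'d) \<Rightarrow> 'v \<Rightarrow> 'v \<Rightarrow> ('v \<times> 'd) \<Rightarrow> ('v \<times> 'd) \<Rightarrow> real" where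
  "conductance w \<sigma> i j = schur_on {p. fst p \<notin> {i, j}} (conn_laplacian w \<sigma>)"

text \<open>The (x,y) block of the conductance matrix (x, y \<in> {i,j}).\<close>
definition cond_block ::
  "('v::finite \<Rightarrow> 'v \<Rightarrow> real) \<Rightarrow> ('v \<Rightarrow> 'v \<Rightarrow> real^'d::finite^'d) \<Rightarrow> 'v \<Rightarrow> 'v \<Rightarrow> 'v \<Rightarrow> 'v \<Rightarrow> real^'d^'d" where
  "cond_block w \<sigma> i j x y = (\<chi> a b. conductance w \<sigma> i j (x, a) (y, b))"

text \<open>Simple random walk: a trajectory X_0 = i, X_1 = p!0, ..., X_k = p!(k-1).\<close>
definition walk_prob :: "('v::finite \<Rightarrow> 'v \<Rightarrow> real) \<Rightarrow> 'v \<Rightarrow> 'v list \<Rightarrow> real" where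
  "walk_prob w i p = (let vs = i # p in
     \<Prod>t<length p. w (vs ! t) (vs ! Suc t) / deg w (vs ! t))"

text \<open>Ordered product \<sigma>_{X_0 X_1} \<sigma>_{X_1 X_2} ... \<sigma>_{X_{k-1} X_k}.\<close>
definition walk_holonomy :: "('v \<Rightarrow> 'v \<Rightarrow> real^'d::finite^'d) \<Rightarrow> 'v \<Rightarrow> 'v list \<Rightarrow> real^'d^'d" where
  "walk_holonomy \<sigma> i p = (let vs = i # p in
     foldl (**) (mat 1) (map (\<lambda>t. \<sigma> (vs ! t) (vs ! Suc t)) [0..<length p]))"

text \<open>Trajectories of length k started at i whose hitting time T^0_j of j equals k.\<close>
definition hit_paths :: "'v::finite \<Rightarrow> 'v \<Rightarrow> nat \<Rightarrow> 'v list set" where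
  "hit_paths i j k = {p. length p = k \<and> (i # p) ! k = j \<and> (\<forall>t<k. (i # p) ! t \<noteq> j)}"

text \<open>\<Omega>^0_{ij} = E[ prod_{l=1}^{T^0_j} \<sigma>_{X_{l-1} X_l} | X_0 = i ], written as the sum over
  all finite trajectories stopped at the hitting time of j.\<close>
definition Omega0 :: "('v::finite \<Rightarrow> 'v \<Rightarrow> real) \<Rightarrow> ('v \<Rightarrow> 'v \<Rightarrow> real^'d::finite^'d) \<Rightarrow> 'v \<Rightarrow> 'v \<Rightarrow> real^'d^'d" where
  "Omega0 w \<sigma> i j = (\<Sum>k. \<Sum>p\<in>hit_paths i j k. walk_prob w i p *\<^sub>R walk_holonomy \<sigma> i p)"

end

theory Submission
  imports Defs
begin

(*
  Write W(x) = Omega0 x j and C_xy for the conductance blocks.  First-step analysis of the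
  walk shows that x |-> W(x) v is harmonic for the connection Laplacian L away from j, with
  W(j) = I.  Since the connection matrices are orthogonal, the norm of an L-harmonic vector
  field obeys a maximum principle, so L restricted to the vertices off a nonempty set is
  nonsingular; in particular the pseudoinverse in the Schur complement is an honest inverse.
  For a field f harmonic off {i, j}, eliminating the interior turns (L f)(i) into
  C_ii f(i) + C_ij f(j); applied to W v this gives C_ii W(i) = -C_ij.  Finally, if C_ii v = 0,
  the harmonic extension of (v at i, 0 at j) is harmonic off j, hence zero by the maximum
  principle, so C_ii is invertible.
*)

lemma norm_orthogonal_matrix: "orthogonal_matrix Q \<Longrightarrow> norm Q = sqrt (real CARD('n))"
  for Q :: "real^'n^'n"
proof -
  assume "orthogonal_matrix Q"
  then have "norm (Q $ i) = 1" for i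
    using orthogonal_matrix_orthonormal_rows[of Q] by (simp add: row_def)
  then show ?thesis by (simp add: norm_vec_def L2_set_def)
qed

lemma norm_orthogonal_matrix_vector: "orthogonal_matrix Q \<Longrightarrow> norm (Q *v v) = norm v"
  for Q :: "real^'n^'n"
  using orthogonal_transformation_matrix[of "(*v) Q"] by (simp add: orthogonal_transformation)

lemma matrix_inv_left: "invertible A \<Longrightarrow> matrix_inv A ** A = mat 1"
  for A :: "'a::field^'n^'n"
  unfolding invertible_def matrix_inv_def by (rule someI2_ex) auto

lemma uminus_matrix_vector_mult: "(- A) *v v = - (A *v v)"
  for A :: "'a::ring_1^'n^'m"
  by (simp add: vec_eq_iff matrix_vector_mult_def sum_negf)

lemma sum_matrix_vector_mult: "(\<Sum>y\<in>A. M y) *v v = (\<Sum>y\<in>A. M y *v v)"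
  by (induction A rule: infinite_finite_induct) (simp_all add: matrix_vector_mult_add_rdistrib)

lemma foldl_matrix_mult: "foldl (**) A l = A ** foldl (**) (mat 1) l"
  for A :: "'a::semiring_1^'n^'n"
proof (induction l arbitrary: A)
  case (Cons B l)
  then show ?case by (metis foldl_Cons matrix_mul_assoc matrix_mul_lid)
qed simp

lemma linear_matrix_mult_left: "linear (\<lambda>B::real^'p^'n. A ** B)"
  by (rule linearI) (simp_all add: matrix_add_ldistrib matrix_scalar_ac scalar_matrix_assoc)

lemma bounded_linear_matrix_mult_left: "bounded_linear (\<lambda>B::real^'p^'n. A ** B)"
  using linear_matrix_mult_left by (simp add: linear_conv_bounded_linear)

lemmas summable_matrix_mult_left = bounded_linear.summable[OF bounded_linear_matrix_mult_left]
lemmas suminf_matrix_mult_left = bounded_linear.suminf[OF bounded_linear_matrix_mult_left]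

lemma sum_UNIV_split_Compl:
  fixes g :: "'i::finite \<Rightarrow> 'a::comm_monoid_add"
  shows "(\<Sum>x\<in>UNIV. g x) = (\<Sum>x\<in>T. g x) + (\<Sum>x\<in>-T. g x)"
  using sum.subset_diff[of T UNIV g] by (simp add: Compl_eq_Diff_UNIV add.commute)

lemma sum_UNIV_pairs: "(\<Sum>q\<in>UNIV. h q) = (\<Sum>y\<in>UNIV. \<Sum>b\<in>UNIV. h (y, b))"
  for h :: "'a::finite \<times> 'b::finite \<Rightarrow> 'c::comm_monoid_add"
  by (subst sum.cartesian_product) (simp add: split_def)

lemma sum_pairs_fst_in_doubleton:
  fixes g :: "'a::finite \<times> 'b::finite \<Rightarrow> 'c::comm_monoid_add"
  assumes "i \<noteq> j"
  shows "(\<Sum>q\<in>{p. fst p \<in> {i, j}}. g q) = (\<Sum>c\<in>UNIV. g (i, c)) + (\<Sum>c\<in>UNIV. g (j, c))"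
proof -
  have "(\<Sum>q\<in>{p. fst p \<in> {i, j}}. g q) = (\<Sum>q\<in>range (Pair i) \<union> range (Pair j). g q)"
    by (rule sum.cong) auto
  also have "\<dots> = (\<Sum>q\<in>range (Pair i). g q) + (\<Sum>q\<in>range (Pair j). g q)"
    by (rule sum.union_disjoint) (use assms in auto)
  finally show ?thesis by (simp add: sum.reindex inj_on_def)
qed

section \<open>Schur complements of a nonsingular block\<close>

definition nonsingular_on :: "'i::finite set \<Rightarrow> ('i \<Rightarrow> 'i \<Rightarrow> real) \<Rightarrow> bool" where
  "nonsingular_on T M \<longleftrightarrow> (\<forall>f. (\<forall>q. q \<notin> T \<longrightarrow> f q = 0) \<and> (\<forall>p\<in>T. (\<Sum>q\<in>UNIV. M p q * f q) = 0)
      \<longrightarrow> (\<forall>q. f q = 0))"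

definition inverse_on :: "'i set \<Rightarrow> ('i \<Rightarrow> 'i \<Rightarrow> real) \<Rightarrow> ('i \<Rightarrow> 'i \<Rightarrow> real) \<Rightarrow> bool" where
  "inverse_on T M X \<longleftrightarrow>
     (\<forall>a\<in>T. \<forall>b\<in>T. mmul_on T M X a b = of_bool (a = b) \<and> mmul_on T X M a b = of_bool (a = b)) \<and>
     (\<forall>a b. a \<notin> T \<or> b \<notin> T \<longrightarrow> X a b = 0)"

lemma mmul_on_assoc: "finite T \<Longrightarrow> mmul_on T (mmul_on T A B) C = mmul_on T A (mmul_on T B C)"
  by (auto simp: mmul_on_def sum_distrib_left sum_distrib_right mult.assoc intro!: ext sum.swap)

lemma mmul_on_id_left:
  assumes "finite T" "a \<in> T" "\<And>c. c \<in> T \<Longrightarrow> E a c = of_bool (a = c)"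
  shows "mmul_on T E Z a b = Z a b"
proof -
  have "mmul_on T E Z a b = (\<Sum>c\<in>T. of_bool (a = c) * Z c b)"
    unfolding mmul_on_def using assms(3) by simp
  then show ?thesis using assms(1,2) by simp
qed

lemma mmul_on_id_right:
  assumes "finite T" "b \<in> T" "\<And>c. c \<in> T \<Longrightarrow> E c b = of_bool (c = b)"
  shows "mmul_on T Z E a b = Z a b"
proof -
  have "mmul_on T Z E a b = (\<Sum>c\<in>T. Z a c * of_bool (c = b))"
    unfolding mmul_on_def using assms(3) by simp
  then show ?thesis using assms(1,2) by simp
qed

lemma mmul_on_cong:
  assumes "\<And>c. c \<in> T \<Longrightarrow> A a c = A' a c" "\<And>c. c \<in> T \<Longrightarrow> B c b = B' c b"
  shows "mmul_on T A B a b = mmul_on T A' B' a b"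
  using assms by (simp add: mmul_on_def)

lemma inverse_onD:
  assumes "inverse_on T M X"
  shows "a \<in> T \<Longrightarrow> b \<in> T \<Longrightarrow> mmul_on T M X a b = of_bool (a = b)"
    and "a \<in> T \<Longrightarrow> b \<in> T \<Longrightarrow> mmul_on T X M a b = of_bool (a = b)"
    and "a \<notin> T \<or> b \<notin> T \<Longrightarrow> X a b = 0"
  using assms by (auto simp: inverse_on_def)

lemma inner_inverse_eq_inverse_on:
  fixes M X Y :: "'i::finite \<Rightarrow> 'i \<Rightarrow> real"
  assumes inv: "inverse_on T M X"
    and Y0: "\<And>a b. a \<notin> T \<or> b \<notin> T \<Longrightarrow> Y a b = 0"
    and MYM: "\<And>a b. a \<in> T \<Longrightarrow> b \<in> T \<Longrightarrow> mmul_on T (mmul_on T M Y) M a b = M a b"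
  shows "Y = X"
proof (intro ext)
  fix a b
  show "Y a b = X a b"
  proof (cases "a \<in> T \<and> b \<in> T")
    case False
    then show ?thesis using Y0 inverse_onD(3)[OF inv] by auto
  next
    case True
    then have a: "a \<in> T" and b: "b \<in> T" by auto
    note MX = inverse_onD(1)[OF inv] and XM = inverse_onD(2)[OF inv]
    have "Y a b = mmul_on T (mmul_on T X M) Y a b"
      by (rule mmul_on_id_left[symmetric]) (use a XM in auto)
    also have "\<dots> = mmul_on T (mmul_on T (mmul_on T X M) Y) (mmul_on T M X) a b"
      by (rule mmul_on_id_right[symmetric]) (use b MX in auto)
    also have "\<dots> = mmul_on T X (mmul_on T (mmul_on T (mmul_on T M Y) M) X) a b"
      by (simp add: mmul_on_assoc)
    also have "\<dots> = mmul_on T X (mmul_on T M X) a b"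
      by (intro mmul_on_cong refl) (use MYM in auto)
    also have "\<dots> = X a b"
      by (rule mmul_on_id_right) (use b MX in auto)
    finally show ?thesis .
  qed
qed

lemma pinv_on_eq_inverse_on:
  fixes M X :: "'i::finite \<Rightarrow> 'i \<Rightarrow> real"
  assumes inv: "inverse_on T M X"
  shows "pinv_on T M = X"
  unfolding pinv_on_def
proof (rule the_equality, intro conjI allI impI ballI)
  fix a b
  assume "a \<notin> T \<or> b \<notin> T"
  then show "X a b = 0" by (rule inverse_onD(3)[OF inv])
next
  fix a b
  assume a: "a \<in> T" and b: "b \<in> T"
  note MX = inverse_onD(1)[OF inv] and XM = inverse_onD(2)[OF inv]
  show "mmul_on T (mmul_on T M X) M a b = M a b"
    by (rule mmul_on_id_left) (use a MX in auto)
  show "mmul_on T (mmul_on T X M) X a b = X a b"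
    by (rule mmul_on_id_left) (use a XM in auto)
  show "mmul_on T M X a b = mmul_on T M X b a" "mmul_on T X M a b = mmul_on T X M b a"
    using a b by (auto simp: MX XM)
qed (use inner_inverse_eq_inverse_on[OF inv] in blast)

definition extend_by_identity :: "'i set \<Rightarrow> ('i::finite \<Rightarrow> 'i \<Rightarrow> real) \<Rightarrow> real^'i^'i" where
  "extend_by_identity T M = (\<chi> a b. if a \<in> T \<and> b \<in> T then M a b else of_bool (a = b))"

lemma sum_extend_by_identity_row:
  assumes "a \<in> T"
  shows "(\<Sum>c\<in>UNIV. extend_by_identity T M $ a $ c * v c) = (\<Sum>c\<in>T. M a c * v c)"
proof -
  have "(\<Sum>c\<in>UNIV. extend_by_identity T M $ a $ c * v c) = (\<Sum>c\<in>T. extend_by_identity T M $ a $ c * v c)"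
    by (rule sum.mono_neutral_right) (use assms in \<open>auto simp: extend_by_identity_def\<close>)
  then show ?thesis using assms by (simp add: extend_by_identity_def)
qed

lemma sum_extend_by_identity_column:
  assumes "b \<in> T"
  shows "(\<Sum>c\<in>UNIV. v c * extend_by_identity T M $ c $ b) = (\<Sum>c\<in>T. v c * M c b)"
proof -
  have "(\<Sum>c\<in>UNIV. v c * extend_by_identity T M $ c $ b) = (\<Sum>c\<in>T. v c * extend_by_identity T M $ c $ b)"
    by (rule sum.mono_neutral_right) (use assms in \<open>auto simp: extend_by_identity_def\<close>)
  then show ?thesis using assms by (simp add: extend_by_identity_def)
qed

lemma extend_by_identity_kernel:
  assumes "nonsingular_on T M" and Ev: "extend_by_identity T M *v v = 0"
  shows "v = 0"
proof -
  have outside: "v $ q = 0" if "q \<notin> T" for q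
  proof -
    have "(extend_by_identity T M *v v) $ q = (\<Sum>c\<in>UNIV. of_bool (q = c) * v $ c)"
      using that by (simp add: matrix_vector_mult_def extend_by_identity_def)
    then show ?thesis using Ev by simp
  qed
  have "(\<Sum>q\<in>UNIV. M p q * v $ q) = 0" if "p \<in> T" for p
  proof -
    have "(\<Sum>q\<in>UNIV. M p q * v $ q) = (\<Sum>q\<in>T. M p q * v $ q)"
      by (rule sum.mono_neutral_right) (auto simp: outside)
    also have "\<dots> = (extend_by_identity T M *v v) $ p"
      using sum_extend_by_identity_row[OF that, of M "\<lambda>c. v $ c"] by (simp add: matrix_vector_mult_def)
    finally show ?thesis using Ev by simp
  qed
  then show "v = 0"
    using assms(1) outside unfolding nonsingular_on_def vec_eq_iff by auto
qed

lemma inverse_on_exists: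
  fixes M :: "'i::finite \<Rightarrow> 'i \<Rightarrow> real"
  assumes "nonsingular_on T M"
  obtains X where "inverse_on T M X"
proof -
  let ?E = "extend_by_identity T M"
  obtain N where NE: "N ** ?E = mat 1"
    using extend_by_identity_kernel[OF assms] matrix_left_invertible_ker by blast
  then have EN: "?E ** N = mat 1" using matrix_left_right_inverse by blast
  define X where "X a b = (if a \<in> T \<and> b \<in> T then N $ a $ b else 0)" for a b
  have "inverse_on T M X"
    unfolding inverse_on_def
  proof (intro conjI allI impI ballI)
    fix a b
    assume a: "a \<in> T" and b: "b \<in> T"
    have "mmul_on T M X a b = (?E ** N) $ a $ b"
      using sum_extend_by_identity_row[OF a, of M "\<lambda>c. N $ c $ b"] b
      by (simp add: mmul_on_def X_def matrix_matrix_mult_def)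
    then show "mmul_on T M X a b = of_bool (a = b)" by (simp add: EN mat_def)
    have "mmul_on T X M a b = (N ** ?E) $ a $ b"
      using sum_extend_by_identity_column[OF b, of "\<lambda>c. N $ a $ c" M] a
      by (simp add: mmul_on_def X_def matrix_matrix_mult_def)
    then show "mmul_on T X M a b = of_bool (a = b)" by (simp add: NE mat_def)
  qed (auto simp: X_def)
  then show ?thesis by (rule that)
qed

lemma inverse_on_harmonic_interior:
  fixes M X :: "'i::finite \<Rightarrow> 'i \<Rightarrow> real"
  assumes inv: "inverse_on T M X" and harmonic: "\<And>p. p \<in> T \<Longrightarrow> (\<Sum>q\<in>UNIV. M p q * f q) = 0"
    and c: "c \<in> T"
  shows "f c = - (\<Sum>e\<in>T. X c e * (\<Sum>q\<in>-T. M e q * f q))"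
proof -
  have interior: "(\<Sum>q\<in>T. M e q * f q) = - (\<Sum>q\<in>-T. M e q * f q)" if "e \<in> T" for e
    using harmonic[OF that] sum_UNIV_split_Compl[of "\<lambda>q. M e q * f q" T] by simp
  have "f c = (\<Sum>q\<in>T. mmul_on T X M c q * f q)"
    using inv c by (simp add: inverse_on_def)
  also have "\<dots> = (\<Sum>e\<in>T. X c e * (\<Sum>q\<in>T. M e q * f q))"
    unfolding mmul_on_def sum_distrib_left sum_distrib_right mult.assoc by (rule sum.swap)
  also have "\<dots> = - (\<Sum>e\<in>T. X c e * (\<Sum>q\<in>-T. M e q * f q))"
    by (simp add: interior sum_negf)
  finally show ?thesis .
qed

lemma schur_on_harmonic:
  fixes M :: "'i::finite \<Rightarrow> 'i \<Rightarrow> real"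
  assumes "nonsingular_on T M" and harmonic: "\<And>p. p \<in> T \<Longrightarrow> (\<Sum>q\<in>UNIV. M p q * f q) = 0"
  shows "(\<Sum>q\<in>UNIV. M p q * f q) = (\<Sum>q\<in>-T. schur_on T M p q * f q)"
proof -
  obtain X where inv: "inverse_on T M X" using inverse_on_exists[OF assms(1)] .
  have "(\<Sum>c\<in>T. M p c * f c) = - (\<Sum>c\<in>T. M p c * (\<Sum>e\<in>T. X c e * (\<Sum>q\<in>-T. M e q * f q)))"
    by (simp add: inverse_on_harmonic_interior[OF inv harmonic] sum_negf)
  also have "\<dots> = - (\<Sum>q\<in>-T. (\<Sum>c\<in>T. \<Sum>e\<in>T. M p c * X c e * M e q) * f q)"
    unfolding sum_distrib_left sum_distrib_right mult.assoc by (simp only: sum.swap[of _ "-T"])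
  finally have "(\<Sum>q\<in>UNIV. M p q * f q)
      = (\<Sum>q\<in>-T. M p q * f q) - (\<Sum>q\<in>-T. (\<Sum>c\<in>T. \<Sum>e\<in>T. M p c * X c e * M e q) * f q)"
    using sum_UNIV_split_Compl[of "\<lambda>q. M p q * f q" T] by simp
  then show ?thesis
    by (simp add: schur_on_def pinv_on_eq_inverse_on[OF inv] sum_subtractf left_diff_distrib)
qed

lemma harmonic_extension_exists:
  fixes M :: "'i::finite \<Rightarrow> 'i \<Rightarrow> real"
  assumes "nonsingular_on T M"
  obtains f where "\<And>q. q \<notin> T \<Longrightarrow> f q = g q" "\<And>p. p \<in> T \<Longrightarrow> (\<Sum>q\<in>UNIV. M p q * f q) = 0"
proof -
  obtain X where inv: "inverse_on T M X" using inverse_on_exists[OF assms] .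
  define h where "h e = (\<Sum>r\<in>-T. M e r * g r)" for e
  define f where "f q = (if q \<in> T then - (\<Sum>e\<in>T. X q e * h e) else g q)" for q
  have "(\<Sum>q\<in>UNIV. M p q * f q) = 0" if p: "p \<in> T" for p
  proof -
    have "(\<Sum>q\<in>T. M p q * f q) = - (\<Sum>q\<in>T. M p q * (\<Sum>e\<in>T. X q e * h e))"
      by (simp add: f_def sum_negf)
    also have "\<dots> = - (\<Sum>e\<in>T. mmul_on T M X p e * h e)"
      unfolding mmul_on_def sum_distrib_left sum_distrib_right mult.assoc by (subst sum.swap) (rule refl)
    also have "\<dots> = - h p"
      using inv p by (simp add: inverse_on_def)
    finally show ?thesis
      using sum_UNIV_split_Compl[of "\<lambda>q. M p q * f q" T] by (simp add: h_def f_def)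
  qed
  then show ?thesis using that[of f] by (simp add: f_def)
qed

section \<open>Walks stopped at a vertex\<close>

lemma walk_prob_Cons: "walk_prob w x (y # p) = w x y / deg w x * walk_prob w y p"
  unfolding walk_prob_def Let_def by (simp add: prod.lessThan_Suc_shift del: prod.lessThan_Suc)

lemma walk_holonomy_Nil [simp]: "walk_holonomy \<sigma> x [] = mat 1"
  by (simp add: walk_holonomy_def)

lemma walk_holonomy_Cons: "walk_holonomy \<sigma> x (y # p) = \<sigma> x y ** walk_holonomy \<sigma> y p"
proof -
  have "[0..<Suc (length p)] = 0 # map Suc [0..<length p]"
    by (subst upt_conv_Cons) (simp_all add: map_Suc_upt)
  then show ?thesis
    unfolding walk_holonomy_def Let_def
    by (simp add: comp_def) (subst foldl_matrix_mult, rule refl)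
qed

lemma finite_hit_paths: "finite (hit_paths (x::'v::finite) j k)"
proof (rule finite_subset)
  show "hit_paths x j k \<subseteq> {p. set p \<subseteq> UNIV \<and> length p = k}"
    by (auto simp: hit_paths_def)
qed (rule finite_lists_length_eq, simp)

lemma hit_paths_self: "hit_paths j j k = (if k = 0 then {[]} else {})"
  by (auto simp: hit_paths_def)

lemma hit_paths_0: "x \<noteq> j \<Longrightarrow> hit_paths x j 0 = {}"
  by (auto simp: hit_paths_def)

lemma hit_paths_Suc:
  assumes "x \<noteq> j"
  shows "hit_paths x j (Suc k) = (\<lambda>(y, p). y # p) ` (SIGMA y:UNIV. hit_paths y j k)"
proof (intro set_eqI iffI)
  fix q
  assume "q \<in> hit_paths x j (Suc k)"
  then show "q \<in> (\<lambda>(y, p). y # p) ` (SIGMA y:UNIV. hit_paths y j k)"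
    by (cases q) (auto simp: hit_paths_def image_iff)
next
  fix q
  assume "q \<in> (\<lambda>(y, p). y # p) ` (SIGMA y:UNIV. hit_paths y j k)"
  then show "q \<in> hit_paths x j (Suc k)"
    using assms by (auto simp: hit_paths_def less_Suc_eq_0_disj)
qed

lemma sum_hit_paths_Suc:
  assumes "x \<noteq> j"
  shows "(\<Sum>q\<in>hit_paths (x::'v::finite) j (Suc k). g q) = (\<Sum>y\<in>UNIV. \<Sum>p\<in>hit_paths y j k. g (y # p))"
proof -
  have "inj_on (\<lambda>(y, p). y # p) (SIGMA y:UNIV. hit_paths y j k)"
    by (auto simp: inj_on_def)
  then show ?thesis
    by (simp add: hit_paths_Suc[OF assms] sum.reindex sum.Sigma finite_hit_paths split_def)
qed

definition hit_prob :: "('v::finite \<Rightarrow> 'v \<Rightarrow> real) \<Rightarrow> 'v \<Rightarrow> 'v \<Rightarrow> nat \<Rightarrow> real" where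
  "hit_prob w x j k = (\<Sum>p\<in>hit_paths x j k. walk_prob w x p)"

definition hit_holonomy ::
  "('v::finite \<Rightarrow> 'v \<Rightarrow> real) \<Rightarrow> ('v \<Rightarrow> 'v \<Rightarrow> real^'d::finite^'d) \<Rightarrow> 'v \<Rightarrow> 'v \<Rightarrow> nat \<Rightarrow> real^'d^'d" where
  "hit_holonomy w \<sigma> x j k = (\<Sum>p\<in>hit_paths x j k. walk_prob w x p *\<^sub>R walk_holonomy \<sigma> x p)"

lemma Omega0_eq_suminf_hit_holonomy: "Omega0 w \<sigma> x j = (\<Sum>k. hit_holonomy w \<sigma> x j k)"
  by (simp add: Omega0_def hit_holonomy_def)

lemma hit_prob_Suc:
  "x \<noteq> j \<Longrightarrow> hit_prob w x j (Suc k) = (\<Sum>y\<in>UNIV. w x y / deg w x * hit_prob w y j k)"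
  by (simp add: hit_prob_def sum_hit_paths_Suc walk_prob_Cons sum_distrib_left)

lemma hit_holonomy_Suc:
  assumes "x \<noteq> j"
  shows "hit_holonomy w \<sigma> x j (Suc k) = (\<Sum>y\<in>UNIV. (w x y / deg w x) *\<^sub>R (\<sigma> x y ** hit_holonomy w \<sigma> y j k))"
  using assms
  by (simp add: hit_holonomy_def sum_hit_paths_Suc walk_prob_Cons walk_holonomy_Cons scaleR_sum_right
      linear_sum[OF linear_matrix_mult_left] linear_scale[OF linear_matrix_mult_left])

lemma Omega0_self: "Omega0 w \<sigma> j j = mat 1"
proof -
  have "hit_holonomy w \<sigma> j j = (\<lambda>k. if k = 0 then mat 1 else 0)"
    by (auto simp: hit_holonomy_def hit_paths_self walk_prob_def)
  then show ?thesis
    using sums_unique[OF sums_single[of 0 "\<lambda>_. mat 1 :: real^'d^'d"], symmetric]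
    by (simp add: Omega0_eq_suminf_hit_holonomy)
qed

section \<open>Connection graphs\<close>

definition conn_laplacian_field ::
  "('v::finite \<Rightarrow> 'v \<Rightarrow> real) \<Rightarrow> ('v \<Rightarrow> 'v \<Rightarrow> real^'d::finite^'d) \<Rightarrow> ('v \<Rightarrow> real^'d) \<Rightarrow> 'v \<Rightarrow> real^'d"
  where "conn_laplacian_field w \<sigma> F x = deg w x *\<^sub>R F x - (\<Sum>y\<in>UNIV. w x y *\<^sub>R (\<sigma> x y *v F y))"

locale conn_graph =
  fixes w :: "'v::finite \<Rightarrow> 'v \<Rightarrow> real" and \<sigma> :: "'v \<Rightarrow> 'v \<Rightarrow> real^'d::finite^'d"
  assumes connection_graph: "connection_graph w \<sigma>"
    and nontrivial: "\<exists>x y::'v. x \<noteq> y" \<comment> \<open>on a single vertex all degrees vanish\<close>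
begin

lemma weight_nonneg: "w x y \<ge> 0"
  using connection_graph unfolding connection_graph_def by blast

lemma weight_self: "w x x = 0"
  using connection_graph unfolding connection_graph_def by blast

lemma connected: "(\<lambda>u v. w u v > 0)\<^sup>*\<^sup>* x y"
  using connection_graph unfolding connection_graph_def by blast

lemma orthogonal_connection: "w x y > 0 \<Longrightarrow> orthogonal_matrix (\<sigma> x y)"
  using connection_graph unfolding connection_graph_def by blast

lemma deg_pos: "deg w x > 0"
proof -
  obtain z where "z \<noteq> x" using nontrivial by metis
  with connected[of x z] obtain y where "w x y > 0"
    by (metis converse_rtranclpE)
  moreover have "w x y \<le> deg w x"
    unfolding deg_def by (rule member_le_sum) (auto simp: weight_nonneg)
  ultimately show ?thesis by simp
qed

lemma transition_prob_sum: "(\<Sum>y\<in>UNIV. w x y / deg w x) = 1"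
  using deg_pos[of x] by (simp add: sum_divide_distrib[symmetric] deg_def)

lemma walk_prob_nonneg: "walk_prob w x p \<ge> 0"
proof (induction p arbitrary: x)
  case (Cons y p)
  then show ?case using deg_pos[of x] weight_nonneg[of x y] by (simp add: walk_prob_Cons)
qed (simp add: walk_prob_def)

lemma orthogonal_walk_holonomy: "walk_prob w x p > 0 \<Longrightarrow> orthogonal_matrix (walk_holonomy \<sigma> x p)"
proof (induction p arbitrary: x)
  case (Cons y p)
  have "0 < (w x y / deg w x) * walk_prob w y p"
    using Cons.prems by (simp only: walk_prob_Cons)
  moreover have "0 \<le> w x y / deg w x" using deg_pos[of x] weight_nonneg[of x y] by simp
  ultimately have "w x y / deg w x > 0" "walk_prob w y p > 0"
    using walk_prob_nonneg[of y p] by (metis le_less mult_zero_left mult_zero_right less_irrefl)+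
  then have "w x y > 0" using deg_pos[of x] by (simp add: zero_less_divide_iff)
  then show ?case
    using Cons.IH \<open>walk_prob w y p > 0\<close> orthogonal_connection
    by (simp add: walk_holonomy_Cons orthogonal_matrix_mul)
qed (simp add: orthogonal_matrix_id)

lemma norm_walk_term_le:
  "norm (walk_prob w x p *\<^sub>R walk_holonomy \<sigma> x p) \<le> sqrt CARD('d) * walk_prob w x p"
proof (cases "walk_prob w x p > 0")
  case True
  then show ?thesis by (simp add: norm_orthogonal_matrix orthogonal_walk_holonomy)
next
  case False
  then show ?thesis using walk_prob_nonneg[of x p] by simp
qed

lemma hit_prob_nonneg: "hit_prob w x j k \<ge> 0"
  unfolding hit_prob_def by (intro sum_nonneg walk_prob_nonneg)

lemma sum_hit_prob_le_1: "(\<Sum>k<n. hit_prob w x j k) \<le> 1"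
proof (induction n arbitrary: x)
  case (Suc n)
  show ?case
  proof (cases "x = j")
    case True
    then show ?thesis
      by (simp add: hit_prob_def hit_paths_self walk_prob_def sum.lessThan_Suc_shift
          del: sum.lessThan_Suc)
  next
    case False
    have "(\<Sum>k<Suc n. hit_prob w x j k) = (\<Sum>k<n. hit_prob w x j (Suc k))"
      using False by (simp add: sum.lessThan_Suc_shift hit_prob_def hit_paths_0 del: sum.lessThan_Suc)
    also have "\<dots> = (\<Sum>y\<in>UNIV. w x y / deg w x * (\<Sum>k<n. hit_prob w y j k))"
      using False by (simp add: hit_prob_Suc sum_distrib_left sum.swap[of _ "{..<n}"])
    also have "\<dots> \<le> (\<Sum>y\<in>UNIV. w x y / deg w x)"
      using Suc.IH deg_pos[of x] weight_nonneg[of x]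
      by (intro sum_mono mult_right_le_one_le) (auto intro: sum_nonneg hit_prob_nonneg)
    also have "\<dots> = 1" by (rule transition_prob_sum)
    finally show ?thesis .
  qed
qed simp

lemma summable_hit_prob: "summable (hit_prob w x j)"
proof (rule bounded_imp_summable)
  show "(\<Sum>k\<le>n. hit_prob w x j k) \<le> 1" for n
    using sum_hit_prob_le_1[where n = "Suc n"] by (simp add: lessThan_Suc_atMost)
qed (rule hit_prob_nonneg)

lemma norm_hit_holonomy_le: "norm (hit_holonomy w \<sigma> x j k) \<le> sqrt CARD('d) * hit_prob w x j k"
  unfolding hit_holonomy_def hit_prob_def sum_distrib_left
  by (rule order_trans[OF norm_sum sum_mono]) (rule norm_walk_term_le)

lemma summable_hit_holonomy: "summable (hit_holonomy w \<sigma> x j)"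
  by (rule summable_comparison_test'[OF summable_mult[OF summable_hit_prob] norm_hit_holonomy_le])

lemma Omega0_harmonic:
  assumes "x \<noteq> j"
  shows "deg w x *\<^sub>R Omega0 w \<sigma> x j = (\<Sum>y\<in>UNIV. w x y *\<^sub>R (\<sigma> x y ** Omega0 w \<sigma> y j))"
proof -
  have "hit_holonomy w \<sigma> x j 0 = 0"
    using assms by (simp add: hit_holonomy_def hit_paths_0)
  then have "Omega0 w \<sigma> x j = (\<Sum>k. hit_holonomy w \<sigma> x j (Suc k))"
    using suminf_split_head[OF summable_hit_holonomy] by (simp add: Omega0_eq_suminf_hit_holonomy)
  also have "\<dots> = (\<Sum>k. \<Sum>y\<in>UNIV. (w x y / deg w x) *\<^sub>R (\<sigma> x y ** hit_holonomy w \<sigma> y j k))"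
    using assms by (simp add: hit_holonomy_Suc)
  also have "\<dots> = (\<Sum>y\<in>UNIV. (w x y / deg w x) *\<^sub>R (\<sigma> x y ** Omega0 w \<sigma> y j))"
    by (simp add: suminf_sum summable_scaleR_right summable_matrix_mult_left summable_hit_holonomy
        suminf_scaleR_right suminf_matrix_mult_left Omega0_eq_suminf_hit_holonomy)
  finally show ?thesis
    using deg_pos[of x] by (simp add: scaleR_sum_right)
qed

lemma Omega0_field_harmonic:
  assumes "x \<noteq> j"
  shows "conn_laplacian_field w \<sigma> (\<lambda>y. Omega0 w \<sigma> y j *v v) x = 0"
proof -
  have "conn_laplacian_field w \<sigma> (\<lambda>y. Omega0 w \<sigma> y j *v v) x
      = (deg w x *\<^sub>R Omega0 w \<sigma> x j - (\<Sum>y\<in>UNIV. w x y *\<^sub>R (\<sigma> x y ** Omega0 w \<sigma> y j))) *v v"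
    by (simp add: conn_laplacian_field_def matrix_vector_mult_diff_rdistrib sum_matrix_vector_mult
        scaleR_matrix_vector_assoc matrix_vector_mul_assoc)
  then show ?thesis by (simp add: Omega0_harmonic[OF assms])
qed

lemma conn_laplacian_apply:
  "(\<Sum>q\<in>UNIV. conn_laplacian w \<sigma> (x, a) q * f q) = conn_laplacian_field w \<sigma> (\<lambda>y. \<chi> c. f (y, c)) x $ a"
proof -
  have entry: "conn_laplacian w \<sigma> (x, a) q
      = of_bool (q = (x, a)) * deg w x - w x (fst q) * \<sigma> x (fst q) $ a $ snd q" for q
    by (cases q) (auto simp: conn_laplacian_def weight_self)
  have "(\<Sum>q\<in>UNIV. conn_laplacian w \<sigma> (x, a) q * f q)
      = (\<Sum>q\<in>UNIV. of_bool (q = (x, a)) * (deg w x * f q))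
        - (\<Sum>q\<in>UNIV. w x (fst q) * (\<sigma> x (fst q) $ a $ snd q * f q))"
    by (simp only: entry left_diff_distrib sum_subtractf mult.assoc)
  also have "(\<Sum>q\<in>UNIV. of_bool (q = (x, a)) * (deg w x * f q)) = deg w x * f (x, a)"
    by simp
  also have "(\<Sum>q\<in>UNIV. w x (fst q) * (\<sigma> x (fst q) $ a $ snd q * f q))
      = (\<Sum>y\<in>UNIV. w x y * (\<Sum>b\<in>UNIV. \<sigma> x y $ a $ b * f (y, b)))"
    by (simp add: sum_UNIV_pairs sum_distrib_left)
  finally show ?thesis
    by (simp add: conn_laplacian_field_def matrix_vector_mult_def)
qed

lemma norm_le_weighted_mean:
  assumes "conn_laplacian_field w \<sigma> F x = 0"
  shows "deg w x * norm (F x) \<le> (\<Sum>y\<in>UNIV. w x y * norm (F y))"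
proof -
  have "deg w x * norm (F x) = norm (deg w x *\<^sub>R F x)"
    using deg_pos[of x] by simp
  also have "\<dots> = norm (\<Sum>y\<in>UNIV. w x y *\<^sub>R (\<sigma> x y *v F y))"
    using assms by (simp add: conn_laplacian_field_def)
  also have "\<dots> \<le> (\<Sum>y\<in>UNIV. norm (w x y *\<^sub>R (\<sigma> x y *v F y)))"
    by (rule norm_sum)
  also have "\<dots> = (\<Sum>y\<in>UNIV. w x y * norm (F y))"
  proof (rule sum.cong[OF refl])
    fix y
    show "norm (w x y *\<^sub>R (\<sigma> x y *v F y)) = w x y * norm (F y)"
      using weight_nonneg[of x y] norm_orthogonal_matrix_vector[OF orthogonal_connection[of x y]]
      by (cases "w x y > 0") auto
  qed
  finally show ?thesis .
qed

lemma norm_neighbour_eq_max: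
  assumes "conn_laplacian_field w \<sigma> F x = 0" and le_m: "\<And>y. norm (F y) \<le> m"
    and "norm (F x) = m" and "w x y > 0"
  shows "norm (F y) = m"
proof -
  have "deg w x * m \<le> (\<Sum>y\<in>UNIV. w x y * norm (F y))"
    using norm_le_weighted_mean[OF assms(1)] assms(3) by simp
  then have "(\<Sum>y\<in>UNIV. w x y * (m - norm (F y))) \<le> 0"
    by (simp add: deg_def right_diff_distrib sum_subtractf sum_distrib_right)
  moreover have nonneg: "0 \<le> w x y * (m - norm (F y))" for y
    using weight_nonneg[of x y] le_m[of y] by simp
  ultimately have "(\<Sum>y\<in>UNIV. w x y * (m - norm (F y))) = 0"
    by (meson antisym sum_nonneg)
  then have "w x y * (m - norm (F y)) = 0"
    using nonneg by (simp add: sum_nonneg_eq_0_iff)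
  then show ?thesis using \<open>w x y > 0\<close> by simp
qed

lemma maximum_principle:
  assumes "z \<in> B" and boundary: "\<And>x. x \<in> B \<Longrightarrow> F x = 0"
    and harmonic: "\<And>x. x \<notin> B \<Longrightarrow> conn_laplacian_field w \<sigma> F x = 0"
  shows "F x = 0"
proof -
  define m where "m = Max (range (\<lambda>x. norm (F x)))"
  have le_m: "norm (F y) \<le> m" for y
    unfolding m_def by (rule Max_ge) auto
  have "m \<in> range (\<lambda>x. norm (F x))"
    unfolding m_def by (rule Max_in) auto
  then obtain x0 where x0: "norm (F x0) = m" by auto
  have reach: "norm (F y) = m" if "(\<lambda>u v. w u v > 0)\<^sup>*\<^sup>* x0 y" for y
    using that
  proof (induction rule: rtranclp_induct)
    case (step x y)
    show ?case
    proof (cases "x \<in> B")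
      case True
      then show ?thesis using step boundary le_m[of y] by simp
    next
      case False
      then show ?thesis using norm_neighbour_eq_max[OF harmonic le_m] step by blast
    qed
  qed (rule x0)
  have "m = 0" using reach[OF connected[of x0 z]] boundary[OF \<open>z \<in> B\<close>] by simp
  then show ?thesis using le_m[of x] by simp
qed

lemma nonsingular_on_conn_laplacian:
  assumes "z \<in> B"
  shows "nonsingular_on {p. fst p \<notin> B} (conn_laplacian w \<sigma>)"
  unfolding nonsingular_on_def
proof (intro allI impI)
  fix f :: "'v \<times> 'd \<Rightarrow> real" and q
  assume f: "(\<forall>q. q \<notin> {p. fst p \<notin> B} \<longrightarrow> f q = 0) \<and>
    (\<forall>p\<in>{p. fst p \<notin> B}. (\<Sum>q\<in>UNIV. conn_laplacian w \<sigma> p q * f q) = 0)"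
  have "(\<chi> c. f (x, c)) = 0" for x
  proof (rule maximum_principle[OF assms])
    fix x
    assume "x \<in> B"
    then show "(\<chi> c. f (x, c)) = 0" using f by (simp add: vec_eq_iff)
  next
    fix x
    assume "x \<notin> B"
    then show "conn_laplacian_field w \<sigma> (\<lambda>x. \<chi> c. f (x, c)) x = 0"
      using f by (simp add: vec_eq_iff conn_laplacian_apply[symmetric])
  qed
  then show "f q = 0"
    by (metis prod.collapse vec_lambda_beta zero_index)
qed

lemma conn_laplacian_eq_conductance:
  assumes "i \<noteq> j"
    and harmonic: "\<And>p. fst p \<notin> {i, j} \<Longrightarrow> (\<Sum>q\<in>UNIV. conn_laplacian w \<sigma> p q * f q) = 0"
  shows "(\<Sum>q\<in>UNIV. conn_laplacian w \<sigma> (x, a) q * f q)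
    = (cond_block w \<sigma> i j x i *v (\<chi> c. f (i, c)) + cond_block w \<sigma> i j x j *v (\<chi> c. f (j, c))) $ a"
proof -
  let ?S = "{p :: 'v \<times> 'd. fst p \<notin> {i, j}}"
  have "nonsingular_on ?S (conn_laplacian w \<sigma>)"
    by (rule nonsingular_on_conn_laplacian[of i]) simp
  then have "(\<Sum>q\<in>UNIV. conn_laplacian w \<sigma> (x, a) q * f q)
      = (\<Sum>q\<in>-?S. schur_on ?S (conn_laplacian w \<sigma>) (x, a) q * f q)"
    by (rule schur_on_harmonic) (use harmonic in auto)
  also have "-?S = {p. fst p \<in> {i, j}}" by auto
  also note sum_pairs_fst_in_doubleton[OF assms(1)]
  finally show ?thesis
    by (simp add: cond_block_def conductance_def matrix_vector_mult_def)
qed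

lemma cond_block_mult_Omega0:
  assumes "i \<noteq> j"
  shows "cond_block w \<sigma> i j i i ** Omega0 w \<sigma> i j = - cond_block w \<sigma> i j i j"
  unfolding matrix_eq
proof
  fix v
  define f where "f q = (Omega0 w \<sigma> (fst q) j *v v) $ snd q" for q
  have field: "(\<chi> c. f (y, c)) = Omega0 w \<sigma> y j *v v" for y
    by (simp add: f_def)
  have harmonic: "(\<Sum>q\<in>UNIV. conn_laplacian w \<sigma> p q * f q) = 0" if "fst p \<noteq> j" for p
    using conn_laplacian_apply[of "fst p" "snd p" f] Omega0_field_harmonic[OF that] field by simp
  have "(cond_block w \<sigma> i j i i *v (Omega0 w \<sigma> i j *v v)
      + cond_block w \<sigma> i j i j *v (Omega0 w \<sigma> j j *v v)) $ a = 0" for a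
    using conn_laplacian_eq_conductance[OF assms, of f i a] harmonic assms by (simp add: field)
  then have "cond_block w \<sigma> i j i i *v (Omega0 w \<sigma> i j *v v) + cond_block w \<sigma> i j i j *v v = 0"
    by (simp add: vec_eq_iff Omega0_self)
  then show "(cond_block w \<sigma> i j i i ** Omega0 w \<sigma> i j) *v v = - cond_block w \<sigma> i j i j *v v"
    by (simp add: matrix_vector_mul_assoc uminus_matrix_vector_mult eq_neg_iff_add_eq_0)
qed

lemma invertible_cond_block:
  assumes "i \<noteq> j"
  shows "invertible (cond_block w \<sigma> i j i i)"
  unfolding invertible_left_inverse matrix_left_invertible_ker
proof (intro allI impI)
  fix v
  assume Cv: "cond_block w \<sigma> i j i i *v v = 0"
  let ?S = "{p :: 'v \<times> 'd. fst p \<notin> {i, j}}"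
  have "nonsingular_on ?S (conn_laplacian w \<sigma>)"
    by (rule nonsingular_on_conn_laplacian[of i]) simp
  then obtain f where boundary: "\<And>q. q \<notin> ?S \<Longrightarrow> f q = (if fst q = i then v $ snd q else 0)"
    and harmonic: "\<And>p. p \<in> ?S \<Longrightarrow> (\<Sum>q\<in>UNIV. conn_laplacian w \<sigma> p q * f q) = 0"
    by (rule harmonic_extension_exists[where g = "\<lambda>q. if fst q = i then v $ snd q else 0"]) auto
  have fi: "(\<chi> c. f (i, c)) = v" and fj: "(\<chi> c. f (j, c)) = 0"
    using boundary assms by (simp_all add: vec_eq_iff)
  have "nonsingular_on {p. fst p \<notin> {j}} (conn_laplacian w \<sigma>)"
    by (rule nonsingular_on_conn_laplacian) simp
  moreover have "\<forall>q. q \<notin> {p. fst p \<notin> {j}} \<longrightarrow> f q = 0"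
    using boundary assms by auto
  moreover have "\<forall>p\<in>{p. fst p \<notin> {j}}. (\<Sum>q\<in>UNIV. conn_laplacian w \<sigma> p q * f q) = 0"
  proof
    fix p :: "'v \<times> 'd"
    assume "p \<in> {p. fst p \<notin> {j}}"
    then consider "fst p \<notin> {i, j}" | a where "p = (i, a)" by (cases p) auto
    then show "(\<Sum>q\<in>UNIV. conn_laplacian w \<sigma> p q * f q) = 0"
    proof cases
      case (2 a)
      then show ?thesis
        using conn_laplacian_eq_conductance[OF assms, of f i a] harmonic by (simp add: fi fj Cv)
    qed (use harmonic in auto)
  qed
  ultimately have "\<forall>q. f q = 0"
    unfolding nonsingular_on_def by blast
  then show "v = 0" using fi by (simp add: vec_eq_iff)
qed

end

theorem lemma5p4:
  fixes w :: "'v::finite \<Rightarrow> 'v \<Rightarrow> real" and \<sigma> :: "'v \<Rightarrow> 'v \<Rightarrow> real^'d::finite^'d"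
    and i j :: 'v
  assumes "connection_graph w \<sigma>" and "i \<noteq> j"
  shows "invertible (cond_block w \<sigma> i j i i) \<and>
         Omega0 w \<sigma> i j = - (matrix_inv (cond_block w \<sigma> i j i i) ** cond_block w \<sigma> i j i j)"
proof -
  interpret conn_graph w \<sigma>
    using assms by unfold_locales blast+
  have invertible: "invertible (cond_block w \<sigma> i j i i)"
    using assms(2) by (rule invertible_cond_block)
  have "Omega0 w \<sigma> i j = matrix_inv (cond_block w \<sigma> i j i i) ** (cond_block w \<sigma> i j i i ** Omega0 w \<sigma> i j)"
    by (simp add: matrix_mul_assoc matrix_inv_left[OF invertible])
  also have "\<dots> = - (matrix_inv (cond_block w \<sigma> i j i i) ** cond_block w \<sigma> i j i j)"
    by (simp add: cond_block_mult_Omega0[OF assms(2)] linear_neg[OF linear_matrix_mult_left])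
  finally show ?thesis using invertible by simp
qed

end
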